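(* Let $\hat\varphi$ be the (unique) fixed point of $S$. Then $0\le\hat\varphi_i(\tau)\le f_i(\tau)$ for all $i\in V$ and $\tau\in L$.
   Context: Let $G=(V,E)$ be an undirected, simple, connected graph with $V=\{1,\dots,n\}$, $n\ge 2$. For $i\in V$ let $N(i)=\{j\in V:\{i,j\}\in E\}$. Let $L$ be a finite set of labels. For each $i\in V$ let $g_i:L\to[0,\infty)$, and for each $\{i,j\}\in E$ let $h_{ij},h_{ji}:L^2\to[0,\infty)$ with $h_{ij}(a,b)=h_{ji}(b,a)$. The energy $F:L^V\to\mathbb R$ is $F(x)=\sum_{i\in V}g_i(x_i)+\sum_{\{i,j\}\in E}h_{ij}(x_i,x_j)$, and the value functions are $f_i(\tau)=\min\{F(x): x\in L^V,\ x_i=\tau\}$. Fix $p\in(0,1)$, $q=1-p$, and weights $w_{ij}\in[0,1]$ for $i\in V$, $j\in N(i)$, with $\sum_{j\in N(i)}w_{ij}=1$ for every $i\in V$. Let $\mathcal{F}$ be the set of tuples $\varphi=(\varphi_1,\dots,\varphi_n)$ with $\varphi_i:L\to\mathbb{R}$. The map $S:\mathcal F\to\mathcal F$ is defined by \[ (S\varphi)_i(\tau)=p\,g_i(\tau)+\sum_{j\in N(i)}w_{ij}\min_{u_j\in L}\Big(p\,h_{ij}(\tau,u_j)+q\,\varphi_j(u_j)\Big). \] (The map $S$ has a unique fixed point.) *)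

theory Defs
  imports Complex_Main "HOL-Library.FuncSet"
begin

definition simple_graph :: "nat set \<Rightarrow> nat set set \<Rightarrow> bool" where
  "simple_graph V E \<longleftrightarrow> (\<forall>e\<in>E. \<exists>i\<in>V. \<exists>j\<in>V. i \<noteq> j \<and> e = {i, j})"

definition connected_graph :: "nat set \<Rightarrow> nat set set \<Rightarrow> bool" where
  "connected_graph V E \<longleftrightarrow> (\<forall>i\<in>V. \<forall>j\<in>V. (i, j) \<in> {(a, b). {a, b} \<in> E}\<^sup>*)"

definition nbrs :: "nat set \<Rightarrow> nat set set \<Rightarrow> nat \<Rightarrow> nat set" where
  "nbrs V E i = {j \<in> V. {i, j} \<in> E}"

text \<open>
  Each undirected edge contributes once; it is represented by its ordered pair \<open>(i, j)\<close> with
  \<open>i < j\<close>. The choice of orientation is immaterial under the symmetry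
  \<open>h i j a b = h j i b a\<close>.
\<close>

definition energy ::
  "nat set \<Rightarrow> nat set set \<Rightarrow> (nat \<Rightarrow> 'l \<Rightarrow> real) \<Rightarrow> (nat \<Rightarrow> nat \<Rightarrow> 'l \<Rightarrow> 'l \<Rightarrow> real) \<Rightarrow>
   (nat \<Rightarrow> 'l) \<Rightarrow> real" where
  "energy V E g h x =
     (\<Sum>i\<in>V. g i (x i)) + (\<Sum>(i, j)\<in>{(i, j). i < j \<and> {i, j} \<in> E}. h i j (x i) (x j))"

definition value_fun ::
  "nat set \<Rightarrow> nat set set \<Rightarrow> 'l set \<Rightarrow> (nat \<Rightarrow> 'l \<Rightarrow> real) \<Rightarrow>
   (nat \<Rightarrow> nat \<Rightarrow> 'l \<Rightarrow> 'l \<Rightarrow> real) \<Rightarrow> nat \<Rightarrow> 'l \<Rightarrow> real" where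
  "value_fun V E L g h i \<tau> = Min {energy V E g h x | x. x \<in> V \<rightarrow>\<^sub>E L \<and> x i = \<tau>}"

text \<open>
  Tuples \<open>(\<phi>\<^sub>i)\<close> of functions \<open>L \<rightarrow> \<real>\<close> are extensional functions on \<open>V\<close> and \<open>L\<close>, so that equality
  of tuples is equality on these carriers.
\<close>

definition tuples :: "nat set \<Rightarrow> 'l set \<Rightarrow> (nat \<Rightarrow> 'l \<Rightarrow> real) set" where
  "tuples V L = V \<rightarrow>\<^sub>E (L \<rightarrow>\<^sub>E UNIV)"

definition S_map ::
  "nat set \<Rightarrow> nat set set \<Rightarrow> 'l set \<Rightarrow> (nat \<Rightarrow> 'l \<Rightarrow> real) \<Rightarrow>
   (nat \<Rightarrow> nat \<Rightarrow> 'l \<Rightarrow> 'l \<Rightarrow> real) \<Rightarrow> real \<Rightarrow> real \<Rightarrow> (nat \<Rightarrow> nat \<Rightarrow> real) \<Rightarrow>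
   (nat \<Rightarrow> 'l \<Rightarrow> real) \<Rightarrow> (nat \<Rightarrow> 'l \<Rightarrow> real)" where
  "S_map V E L g h p q w \<phi> =
     (\<lambda>i\<in>V. \<lambda>\<tau>\<in>L. p * g i \<tau> +
        (\<Sum>j\<in>nbrs V E i. w i j * Min ((\<lambda>u. p * h i j \<tau> u + q * \<phi> j u) ` L)))"

end

theory Submission
  imports Defs
begin

text \<open>
  Both bounds are maximum principles for averaging with contraction factor \<open>q < 1\<close>. At a pair
  \<open>(i, \<tau>)\<close> minimising \<open>\<phi>\<close> with value \<open>m\<close>, the fixed point equation gives \<open>m \<ge> q m\<close>, so \<open>m \<ge> 0\<close>.
  For the upper bound, fix a labelling \<open>x\<close> and choose \<open>u = x j\<close> in every minimum: with
  \<open>y i = \<phi> i (x i)\<close> one gets \<open>y i \<le> p F(x) + q \<Sum>\<^sub>j w i j * y j\<close>, because \<open>g i (x i)\<close> plus a weighted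
  average of single edge costs is at most \<open>F(x)\<close>. At a vertex maximising \<open>y\<close> this yields
  \<open>y i \<le> F(x)\<close>.
\<close>

lemma weighted_average_le:
  fixes w a :: "'b \<Rightarrow> real"
  assumes "\<And>j. j \<in> N \<Longrightarrow> 0 \<le> w j" and "(\<Sum>j\<in>N. w j) = 1" and "\<And>j. j \<in> N \<Longrightarrow> a j \<le> c"
  shows "(\<Sum>j\<in>N. w j * a j) \<le> c"
proof -
  have "(\<Sum>j\<in>N. w j * a j) \<le> (\<Sum>j\<in>N. w j * c)"
    using assms(1,3) by (intro sum_mono mult_left_mono) auto
  also have "\<dots> = c"
    using assms(2) by (simp add: sum_distrib_right[symmetric])
  finally show ?thesis .
qed

lemma weighted_average_ge:
  fixes w a :: "'b \<Rightarrow> real"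
  assumes "\<And>j. j \<in> N \<Longrightarrow> 0 \<le> w j" and "(\<Sum>j\<in>N. w j) = 1" and "\<And>j. j \<in> N \<Longrightarrow> c \<le> a j"
  shows "c \<le> (\<Sum>j\<in>N. w j * a j)"
  using weighted_average_le[of N w "\<lambda>j. - a j" "- c"] assms by (simp add: sum_negf)

text \<open>At a maximiser \<open>k\<close> of \<open>y\<close> over the finite set
  \<open>V\<close>, the average on the right is at most \<open>y k\<close>. The inequality for
  \<open>k\<close> then involves \<open>y k\<close> alone, and \<open>0 < p\<close> lets
  \<open>p\<close> be cancelled.\<close>

lemma averaging_maximum_principle:
  fixes y :: "'b \<Rightarrow> real" and w :: "'b \<Rightarrow> 'b \<Rightarrow> real"
  assumes "finite V" and "\<And>i. i \<in> V \<Longrightarrow> N i \<subseteq> V"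
    and w0: "\<And>i j. i \<in> V \<Longrightarrow> j \<in> N i \<Longrightarrow> 0 \<le> w i j"
    and w1: "\<And>i. i \<in> V \<Longrightarrow> (\<Sum>j\<in>N i. w i j) = 1"
    and "0 < p" and "p \<le> 1"
    and y: "\<And>i. i \<in> V \<Longrightarrow> y i \<le> p * c + (1 - p) * (\<Sum>j\<in>N i. w i j * y j)"
    and "i \<in> V"
  shows "y i \<le> c"
proof -
  have fin: "finite (y ` V)" and ne: "y ` V \<noteq> {}"
    using assms(1) \<open>i \<in> V\<close> by auto
  then obtain k where k: "k \<in> V" "y k = Max (y ` V)"
    by (metis Max_in imageE)
  have max: "y j \<le> y k" if "j \<in> V" for j
    using that k(2) fin by simp
  have "(\<Sum>j\<in>N k. w k j * y j) \<le> y k"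
    by (rule weighted_average_le) (use w0 w1 k(1) max assms(2) in blast)+
  then have "y k \<le> p * c + (1 - p) * y k"
    using y[OF k(1)] \<open>p \<le> 1\<close> mult_left_mono[of "\<Sum>j\<in>N k. w k j * y j" "y k" "1 - p"] by linarith
  then have "p * y k \<le> p * c"
    by (simp add: algebra_simps)
  then have "y k \<le> c"
    using \<open>0 < p\<close> by simp
  then show ?thesis
    using max[OF \<open>i \<in> V\<close>] by simp
qed

lemma finite_ordered_edges:
  assumes "finite V" and "simple_graph V E"
  shows "finite {(i, j). i < j \<and> {i, j} \<in> E}"
proof (rule finite_subset)
  show "{(i, j). i < j \<and> {i, j} \<in> E} \<subseteq> V \<times> V"
    using assms(2) unfolding simple_graph_def by (fastforce simp: doubleton_eq_iff)
qed (use assms(1) in simp)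

lemma simple_graph_edgeD:
  assumes "simple_graph V E" and "{i, j} \<in> E"
  shows "i \<in> V" and "j \<in> V" and "i \<noteq> j"
  using assms unfolding simple_graph_def by (fastforce simp: doubleton_eq_iff)+

text \<open>All summands are nonnegative, so any one of them is below the sum. The sum lists an edge
  only in its increasing orientation; for \<open>j < i\<close> the symmetry of \<open>h\<close>
  turns the cost into the listed summand.\<close>

lemma edge_cost_le_sum:
  fixes h :: "nat \<Rightarrow> nat \<Rightarrow> 'l \<Rightarrow> 'l \<Rightarrow> real"
  assumes "finite V" and graph: "simple_graph V E"
    and h0: "\<And>i j a b. {i, j} \<in> E \<Longrightarrow> a \<in> L \<Longrightarrow> b \<in> L \<Longrightarrow> 0 \<le> h i j a b"
    and sym: "\<And>i j a b. {i, j} \<in> E \<Longrightarrow> a \<in> L \<Longrightarrow> b \<in> L \<Longrightarrow> h i j a b = h j i b a"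
    and x: "x \<in> V \<rightarrow> L" and e: "{i, j} \<in> E"
  shows "h i j (x i) (x j) \<le> (\<Sum>(k, l)\<in>{(k, l). k < l \<and> {k, l} \<in> E}. h k l (x k) (x l))"
    (is "_ \<le> sum ?f ?P")
proof -
  have xL: "x k \<in> L" "x l \<in> L" if "{k, l} \<in> E" for k l
    using simple_graph_edgeD[OF graph that] x by auto
  have member: "h k l (x k) (x l) \<le> sum ?f ?P" if "k < l" "{k, l} \<in> E" for k l
  proof -
    have "?f (k, l) \<le> sum ?f ?P"
      by (rule member_le_sum)
        (use that h0 xL finite_ordered_edges[OF assms(1) graph] in auto)
    then show ?thesis by simp
  qed
  have "i < j \<or> j < i"
    using simple_graph_edgeD(3)[OF graph e] by auto
  then show ?thesis
  proof
    assume "j < i"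
    moreover have "{j, i} \<in> E" using e by (simp add: insert_commute)
    ultimately show ?thesis using member[of j i] sym[OF e xL[OF e]] by simp
  qed (use member e in simp)
qed

text \<open>The vertex cost is one summand of the vertex sum. Every incident edge cost is below the
  whole edge sum, hence so is their average, because the weights add up to 1.\<close>

lemma local_cost_le_energy:
  fixes g :: "nat \<Rightarrow> 'l \<Rightarrow> real" and h :: "nat \<Rightarrow> nat \<Rightarrow> 'l \<Rightarrow> 'l \<Rightarrow> real"
  assumes "finite V" and "simple_graph V E"
    and g0: "\<And>i a. i \<in> V \<Longrightarrow> a \<in> L \<Longrightarrow> 0 \<le> g i a"
    and "\<And>i j a b. {i, j} \<in> E \<Longrightarrow> a \<in> L \<Longrightarrow> b \<in> L \<Longrightarrow> 0 \<le> h i j a b"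
    and "\<And>i j a b. {i, j} \<in> E \<Longrightarrow> a \<in> L \<Longrightarrow> b \<in> L \<Longrightarrow> h i j a b = h j i b a"
    and "\<And>j. j \<in> nbrs V E i \<Longrightarrow> 0 \<le> w j" and "(\<Sum>j\<in>nbrs V E i. w j) = 1"
    and x: "x \<in> V \<rightarrow> L" and i: "i \<in> V"
  shows "g i (x i) + (\<Sum>j\<in>nbrs V E i. w j * h i j (x i) (x j)) \<le> energy V E g h x"
  unfolding energy_def
proof (rule add_mono)
  show "g i (x i) \<le> (\<Sum>i\<in>V. g i (x i))"
    by (rule member_le_sum[of i V "\<lambda>i. g i (x i)"]) (use i x g0 assms(1) in auto)
  show "(\<Sum>j\<in>nbrs V E i. w j * h i j (x i) (x j))
      \<le> (\<Sum>(k, l)\<in>{(k, l). k < l \<and> {k, l} \<in> E}. h k l (x k) (x l))"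
  proof (rule weighted_average_le)
    fix j assume "j \<in> nbrs V E i"
    then have "{i, j} \<in> E" by (simp add: nbrs_def)
    then show "h i j (x i) (x j) \<le> (\<Sum>(k, l)\<in>{(k, l). k < l \<and> {k, l} \<in> E}. h k l (x k) (x l))"
      using edge_cost_le_sum[OF assms(1,2)] assms(4,5) x by blast
  qed (use assms(6,7) in auto)
qed

text \<open>Reduces a lower bound on the minimum to single labellings. The set of energies is finite
  since \<open>V \<rightarrow>\<^sub>E L\<close> is, and the constant labelling
  \<open>\<tau>\<close> shows that it is nonempty.\<close>

lemma le_value_funI:
  assumes "finite V" and "finite L" and "i \<in> V" and "\<tau> \<in> L"
    and "\<And>x. x \<in> V \<rightarrow>\<^sub>E L \<Longrightarrow> x i = \<tau> \<Longrightarrow> c \<le> energy V E g h x"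
  shows "c \<le> value_fun V E L g h i \<tau>"
proof -
  have "finite {energy V E g h x | x. x \<in> V \<rightarrow>\<^sub>E L \<and> x i = \<tau>}"
    by (rule finite_subset[of _ "energy V E g h ` (V \<rightarrow>\<^sub>E L)"])
      (use assms(1,2) in \<open>auto intro: finite_PiE\<close>)
  moreover have "(\<lambda>k\<in>V. \<tau>) \<in> V \<rightarrow>\<^sub>E L \<and> (\<lambda>k\<in>V. \<tau>) i = \<tau>"
    using assms(3,4) by auto
  then have "{energy V E g h x | x. x \<in> V \<rightarrow>\<^sub>E L \<and> x i = \<tau>} \<noteq> {}"
    by blast
  ultimately show ?thesis
    unfolding value_fun_def using assms(5) by (subst Min_ge_iff) auto
qed

theorem theorem5:
  fixes n :: nat and V :: "nat set" and E :: "nat set set" and L :: "'l set"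
    and g :: "nat \<Rightarrow> 'l \<Rightarrow> real" and h :: "nat \<Rightarrow> nat \<Rightarrow> 'l \<Rightarrow> 'l \<Rightarrow> real"
    and p q :: real and w :: "nat \<Rightarrow> nat \<Rightarrow> real" and \<phi> :: "nat \<Rightarrow> 'l \<Rightarrow> real"
  assumes "n \<ge> 2" and "V = {1..n}"
    and "simple_graph V E" and "connected_graph V E"
    and "finite L"
    and "\<forall>i\<in>V. \<forall>a\<in>L. g i a \<ge> 0"
    and "\<forall>i j. {i, j} \<in> E \<longrightarrow> (\<forall>a\<in>L. \<forall>b\<in>L. h i j a b \<ge> 0)"
    and "\<forall>i j. {i, j} \<in> E \<longrightarrow> (\<forall>a\<in>L. \<forall>b\<in>L. h i j a b = h j i b a)"
    and "0 < p" and "p < 1" and "q = 1 - p"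
    and "\<forall>i\<in>V. \<forall>j\<in>nbrs V E i. 0 \<le> w i j \<and> w i j \<le> 1"
    and "\<forall>i\<in>V. (\<Sum>j\<in>nbrs V E i. w i j) = 1"
    and "\<phi> \<in> tuples V L" and "S_map V E L g h p q w \<phi> = \<phi>"
  shows "\<forall>i\<in>V. \<forall>\<tau>\<in>L. 0 \<le> \<phi> i \<tau> \<and> \<phi> i \<tau> \<le> value_fun V E L g h i \<tau>"
proof (intro ballI conjI)
  fix i \<tau> assume i: "i \<in> V" and \<tau>: "\<tau> \<in> L"
  have finV: "finite V" using assms(2) by simp
  have nbrs: "nbrs V E k \<subseteq> V" for k by (auto simp: nbrs_def)
  have w0: "0 \<le> w k j" if "k \<in> V" "j \<in> nbrs V E k" for k j
    using assms(12) that by blast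
  have w1: "(\<Sum>j\<in>nbrs V E k. w k j) = 1" if "k \<in> V" for k
    using assms(13) that by blast
  \<comment> \<open>On the carriers \<open>V\<close> and \<open>L\<close> the restricted
    abstractions in \<open>S_map\<close> reduce, so the equality of tuples becomes a pointwise
    equation.\<close>
  have fixpoint: "\<phi> k a = p * g k a +
      (\<Sum>j\<in>nbrs V E k. w k j * Min ((\<lambda>u. p * h k j a u + q * \<phi> j u) ` L))"
    if "k \<in> V" "a \<in> L" for k a
    using fun_cong[OF fun_cong[OF assms(15), of k], of a] that by (simp add: S_map_def)

  show "0 \<le> \<phi> i \<tau>"
  proof -
    \<comment> \<open>The minimum runs over vertices and labels jointly, so that it bounds
      \<open>\<phi> j u\<close> for every neighbour \<open>j\<close> and every label
      \<open>u\<close> in the inner minimum.\<close>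
    define A where "A = (\<lambda>(k, a). \<phi> k a) ` (V \<times> L)"
    have finA: "finite A" and memA: "\<And>k a. k \<in> V \<Longrightarrow> a \<in> L \<Longrightarrow> \<phi> k a \<in> A"
      using finV assms(5) by (auto simp: A_def)
    then have "Min A \<in> A" using i \<tau> by (intro Min_in) auto
    then obtain k a where k: "k \<in> V" "a \<in> L" and m: "\<phi> k a = Min A"
      by (auto simp: A_def)
    have "q * Min A \<le> (\<Sum>j\<in>nbrs V E k. w k j * Min ((\<lambda>u. p * h k j a u + q * \<phi> j u) ` L))"
    proof (rule weighted_average_ge)
      fix j assume j: "j \<in> nbrs V E k"
      then have jV: "j \<in> V" and e: "{k, j} \<in> E" by (auto simp: nbrs_def)
      have "q * Min A \<le> p * h k j a u + q * \<phi> j u" if u: "u \<in> L" for u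
      proof -
        have "q * Min A \<le> q * \<phi> j u"
          using finA memA[OF jV u] assms(10,11) by (intro mult_left_mono) auto
        moreover have "0 \<le> p * h k j a u"
          using assms(7,9) e k u by simp
        ultimately show ?thesis by simp
      qed
      \<comment> \<open>Here \<open>\<tau>\<close> only witnesses that \<open>L\<close> is
        nonempty.\<close>
      then show "q * Min A \<le> Min ((\<lambda>u. p * h k j a u + q * \<phi> j u) ` L)"
        using assms(5) \<tau> by (subst Min_ge_iff) auto
    qed (use w0 w1 k in auto)
    moreover have "0 \<le> p * g k a" using assms(6,9) k by simp
    ultimately have "q * Min A \<le> Min A" using fixpoint[OF k] m by linarith
    then have "0 \<le> p * Min A" using assms(11) by (simp add: algebra_simps)
    then have "0 \<le> Min A" using assms(9) by (simp add: zero_le_mult_iff)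
    also have "Min A \<le> \<phi> i \<tau>" using finA memA i \<tau> by simp
    finally show ?thesis .
  qed

  show "\<phi> i \<tau> \<le> value_fun V E L g h i \<tau>"
  proof (rule le_value_funI)
    fix x assume x: "x \<in> V \<rightarrow>\<^sub>E L" and xi: "x i = \<tau>"
    have xL: "x k \<in> L" if "k \<in> V" for k using x that by auto
    have "\<phi> i (x i) \<le> energy V E g h x"
    \<comment> \<open>The bound is proved along the whole labelling, with
      \<open>energy V E g h x\<close> as the constant \<open>c\<close>, because the inequality at
      one vertex involves the values at its neighbours.\<close>
    proof (rule averaging_maximum_principle[of V "nbrs V E" w p "\<lambda>k. \<phi> k (x k)"])
      fix k assume k: "k \<in> V"
      let ?N = "nbrs V E k"
      \<comment> \<open>Each minimum is at most its entry at \<open>u = x j\<close>, which is a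
        label because \<open>j\<close> lies in \<open>V\<close>; nonnegative weights preserve the
        inequality.\<close>
      have "\<phi> k (x k) \<le> p * g k (x k) +
          (\<Sum>j\<in>?N. w k j * (p * h k j (x k) (x j) + q * \<phi> j (x j)))"
        unfolding fixpoint[OF k xL[OF k]]
        using w0[OF k] xL nbrs[of k] assms(5)
        by (intro add_left_mono sum_mono mult_left_mono Min_le) auto
      also have "\<dots> = p * (g k (x k) + (\<Sum>j\<in>?N. w k j * h k j (x k) (x j)))
          + q * (\<Sum>j\<in>?N. w k j * \<phi> j (x j))"
        by (simp add: sum.distrib sum_distrib_left algebra_simps)
      also have "\<dots> \<le> p * energy V E g h x + q * (\<Sum>j\<in>?N. w k j * \<phi> j (x j))"
      proof (intro add_right_mono mult_left_mono)
        show "g k (x k) + (\<Sum>j\<in>?N. w k j * h k j (x k) (x j)) \<le> energy V E g h x"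
          by (rule local_cost_le_energy[of V E L])
            (use finV assms(3,6-8) w0 w1 k x in \<open>blast+\<close>)
      qed (use assms(9) in simp)
      finally show "\<phi> k (x k) \<le> p * energy V E g h x
          + (1 - p) * (\<Sum>j\<in>?N. w k j * \<phi> j (x j))"
        using assms(11) by simp
    qed (use finV nbrs w0 w1 assms(9,10) i in auto)
    then show "\<phi> i \<tau> \<le> energy V E g h x" using xi by simp
  qed (use finV assms(5) i \<tau> in auto)
qed

end
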